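(* Let $p$ be a prime. Then the cozero-divisor graph $\Gamma'(\mathbb{Z}_p[x]/(x^2))$ is isomorphic to $\overline{K}_{p-1}$, the graph with $p-1$ vertices and no edges.
   Context: For a commutative ring $R$ with nonzero identity, the cozero-divisor graph $\Gamma'(R)$ is the simple undirected graph whose vertices are the nonzero non-unit elements of $R$, with two distinct vertices $u,v$ adjacent if and only if $u\notin Rv$ and $v\notin Ru$. $\mathbb{Z}_n$ denotes the ring of integers modulo $n$. *)

theory Defs
  imports
    "HOL-Number_Theory.Residues"
    "HOL-Algebra.Polynomial_Divisibility"
    "Graph_Theory.Pair_Digraph"
    "Graph_Theory.Digraph_Isomorphism"
begin

text \<open>
  Simple undirected graphs are represented as symmetric loop-free pair digraphs, as is usual
  in the imported graph library: an edge between \<open>u\<close> and \<open>v\<close> is the pair of arcs \<open>(u, v)\<close>, \<open>(v, u)\<close>.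
  Between such graphs an isomorphism in the sense of \<^const>\<open>digraph_iso\<close> is a bijection of
  vertices that preserves and reflects adjacency.
\<close>

text \<open>The intended domain is commutative rings \<open>R\<close> with nonzero identity, where
  \<^term>\<open>PIdl\<^bsub>R\<^esub> v\<close> is \<open>R v\<close>.\<close>

definition cozero_divisor_graph :: "('a, 'm) ring_scheme \<Rightarrow> 'a pair_pre_digraph" where
  "cozero_divisor_graph R =
     (let V = carrier R - {\<zero>\<^bsub>R\<^esub>} - Units R in
       \<lparr> pverts = V,
         parcs = {(u, v). u \<in> V \<and> v \<in> V \<and> u \<noteq> v \<and> u \<notin> PIdl\<^bsub>R\<^esub> v \<and> v \<notin> PIdl\<^bsub>R\<^esub> u} \<rparr>)"

lemma pair_bidirected_digraph_cozero_divisor_graph: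
  "pair_bidirected_digraph (cozero_divisor_graph R)"
  by unfold_locales
    (auto simp: cozero_divisor_graph_def Let_def intro!: symI
       simp: symmetric_def)

definition edgeless_graph :: "nat \<Rightarrow> nat pair_pre_digraph" where
  "edgeless_graph n = \<lparr> pverts = {..<n}, parcs = {} \<rparr>"

definition Zp_x_mod_x2 :: "nat \<Rightarrow> int list set ring" where
  "Zp_x_mod_x2 p =
     (let Z = residue_ring (int p); P = univ_poly Z (carrier Z)
      in P Quot (PIdl\<^bsub>P\<^esub> (X\<^bsub>Z\<^esub> [^]\<^bsub>P\<^esub> (2::nat))))"

end

theory Submission
  imports Defs
begin

text \<open>
  Every element of \<open>F[x]/(x\<^sup>2)\<close> has the form \<open>\<phi> b + \<phi> a m\<close>,
  with \<open>m\<close> the class of \<open>x\<close> and \<open>\<phi>\<close> the embedding of the field \<open>F\<close>.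
  Since \<open>m\<^sup>2 = 0\<close>, the product of \<open>\<phi> b + \<phi> a m\<close> and \<open>\<phi> b - \<phi> a m\<close> is \<open>(\<phi> b)\<^sup>2\<close>, so the
  nonunits are the multiples \<open>\<phi> a m\<close>. For \<open>a \<noteq> 0\<close> these are \<open>\<bar>F\<bar> - 1\<close> distinct elements,
  and they all generate the ideal of \<open>m\<close>, hence no two of them are adjacent.
\<close>

text \<open>With no arcs to respect, any bijection between the vertex sets is an isomorphism, so
  counting vertices suffices.\<close>

lemma digraph_iso_edgeless_graphI:
  assumes fin: "finite (pverts G)" and card: "card (pverts G) = n" and arcs: "parcs G = {}"
  shows "digraph_iso (with_proj G) (with_proj (edgeless_graph n))"
proof -
  obtain f where f: "bij_betw f (pverts G) {..<n}"
    using finite_same_card_bij[OF fin, of "{..<n}"] card by auto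
  \<comment> \<open>\<open>app_iso\<close> copies \<open>iso_head\<close> and
    \<open>iso_tail\<close> into its result, so \<open>snd\<close> and \<open>fst\<close> make the
    image literally a \<open>with_proj\<close> graph.\<close>
  let ?h = "\<lparr> iso_verts = f, iso_arcs = map_prod f f, iso_head = snd, iso_tail = fst \<rparr>"
  have "wf_digraph (with_proj G)"
    by unfold_locales (simp_all add: arcs)
  hence "pre_digraph.digraph_isomorphism (with_proj G) ?h"
    using f by (simp add: pre_digraph.digraph_isomorphism_def arcs bij_betw_def)
  moreover have "with_proj (edgeless_graph n) = app_iso ?h (with_proj G)"
    using f by (simp add: app_iso_def with_proj_def edgeless_graph_def arcs bij_betw_def)
  ultimately show ?thesis
    unfolding digraph_iso_def by blast
qed

text \<open>This abstracts \<open>F[x]/(x^2)\<close> away from lists and cosets.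
  \<open>dual_decomp\<close> asks only for existence; the injectivity needed for counting is derived
  from \<open>m_nonzero\<close>.\<close>

locale dual_numbers = ring_hom_cring R S \<phi> + field R
  for R (structure) and S (structure) and \<phi> +
  fixes m
  assumes m_closed [simp, intro]: "m \<in> carrier S"
    and m_square: "m \<otimes>\<^bsub>S\<^esub> m = \<zero>\<^bsub>S\<^esub>"
    and m_nonzero: "m \<noteq> \<zero>\<^bsub>S\<^esub>"
    and dual_decomp: "\<And>x. x \<in> carrier S \<Longrightarrow>
      \<exists>a \<in> carrier R. \<exists>b \<in> carrier R. x = \<phi> b \<oplus>\<^bsub>S\<^esub> \<phi> a \<otimes>\<^bsub>S\<^esub> m"
begin

lemma hom_Unit:
  assumes "b \<in> carrier R" "b \<noteq> \<zero>"
  shows "\<phi> b \<in> Units S"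
proof -
  have b: "b \<in> Units R"
    using assms by (simp add: field_Units)
  hence "\<phi> (inv b) \<otimes>\<^bsub>S\<^esub> \<phi> b = \<one>\<^bsub>S\<^esub>" "\<phi> b \<otimes>\<^bsub>S\<^esub> \<phi> (inv b) = \<one>\<^bsub>S\<^esub>"
    using assms b by (simp_all flip: hom_mult)
  thus ?thesis
    unfolding Units_def using assms b by auto
qed

lemma inv_cancel_scaled:
  assumes "a \<in> carrier R" "a \<noteq> \<zero>"
  shows "inv\<^bsub>S\<^esub> (\<phi> a) \<otimes>\<^bsub>S\<^esub> (\<phi> a \<otimes>\<^bsub>S\<^esub> m) = m"
  using assms hom_Unit[OF assms] by (simp flip: S.m_assoc)

lemma scaled_eq_zero_iff:
  assumes "a \<in> carrier R"
  shows "\<phi> a \<otimes>\<^bsub>S\<^esub> m = \<zero>\<^bsub>S\<^esub> \<longleftrightarrow> a = \<zero>"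
proof
  assume eq: "\<phi> a \<otimes>\<^bsub>S\<^esub> m = \<zero>\<^bsub>S\<^esub>"
  show "a = \<zero>"
  proof (rule ccontr)
    assume "a \<noteq> \<zero>"
    then show False
      using inv_cancel_scaled[OF assms] hom_Unit[OF assms] eq m_nonzero by simp
  qed
qed (simp add: hom_zero)

text \<open>Such an element annihilates \<open>m\<close>, whereas a unit annihilates only
  zero.\<close>

lemma scaled_not_Unit:
  assumes "a \<in> carrier R"
  shows "\<phi> a \<otimes>\<^bsub>S\<^esub> m \<notin> Units S"
proof
  assume u: "\<phi> a \<otimes>\<^bsub>S\<^esub> m \<in> Units S"
  have "(\<phi> a \<otimes>\<^bsub>S\<^esub> m) \<otimes>\<^bsub>S\<^esub> m = \<zero>\<^bsub>S\<^esub>"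
    using assms by (simp add: S.m_assoc m_square)
  then have "m = \<zero>\<^bsub>S\<^esub>"
    using u assms by (metis S.Units_inv_closed S.Units_l_inv S.l_one S.m_assoc S.r_null
      S.Units_closed m_closed)
  then show False
    using m_nonzero by simp
qed

text \<open>Multiplying by the conjugate gives the square of the unit \<open>\<phi> b\<close>, and
  in a commutative ring a factor of a unit is a unit.\<close>

lemma Unit_if_const_nonzero:
  assumes a: "a \<in> carrier R" and b: "b \<in> carrier R" "b \<noteq> \<zero>"
  shows "\<phi> b \<oplus>\<^bsub>S\<^esub> \<phi> a \<otimes>\<^bsub>S\<^esub> m \<in> Units S"
proof -
  let ?x = "\<phi> a \<otimes>\<^bsub>S\<^esub> m" and ?y = "\<phi> b"
  have x: "?x \<in> carrier S" and y: "?y \<in> carrier S"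
    using a b by simp_all
  have "?x \<otimes>\<^bsub>S\<^esub> ?x = (\<phi> a \<otimes>\<^bsub>S\<^esub> \<phi> a) \<otimes>\<^bsub>S\<^esub> (m \<otimes>\<^bsub>S\<^esub> m)"
    using a by (simp add: S.m_ac)
  hence sq: "?x \<otimes>\<^bsub>S\<^esub> ?x = \<zero>\<^bsub>S\<^esub>"
    using a by (simp add: m_square)
  have "(?y \<oplus>\<^bsub>S\<^esub> ?x) \<otimes>\<^bsub>S\<^esub> (?y \<ominus>\<^bsub>S\<^esub> ?x) = ?y \<otimes>\<^bsub>S\<^esub> ?y \<ominus>\<^bsub>S\<^esub> ?x \<otimes>\<^bsub>S\<^esub> ?x"
    using x y by algebra
  also have "\<dots> = ?y \<otimes>\<^bsub>S\<^esub> ?y"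
    using y unfolding sq by algebra
  finally have "(?y \<oplus>\<^bsub>S\<^esub> ?x) \<otimes>\<^bsub>S\<^esub> (?y \<ominus>\<^bsub>S\<^esub> ?x) \<in> Units S"
    using hom_Unit[OF b] by simp
  thus ?thesis
    using x y by (metis S.unit_factor S.add.m_closed S.minus_closed)
qed

text \<open>This determines the vertex set of the cozero-divisor graph of \<open>S\<close>.\<close>

lemma nonzero_nonunits:
  "carrier S - {\<zero>\<^bsub>S\<^esub>} - Units S = (\<lambda>a. \<phi> a \<otimes>\<^bsub>S\<^esub> m) ` (carrier R - {\<zero>})"
proof (intro equalityI subsetI)
  fix x assume x: "x \<in> carrier S - {\<zero>\<^bsub>S\<^esub>} - Units S"
  then obtain a b where ab: "a \<in> carrier R" "b \<in> carrier R" "x = \<phi> b \<oplus>\<^bsub>S\<^esub> \<phi> a \<otimes>\<^bsub>S\<^esub> m"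
    using dual_decomp by blast
  have "b = \<zero>"
    using Unit_if_const_nonzero ab x by blast
  hence eq: "x = \<phi> a \<otimes>\<^bsub>S\<^esub> m"
    using ab by simp
  hence "a \<noteq> \<zero>"
    using x scaled_eq_zero_iff ab by auto
  thus "x \<in> (\<lambda>a. \<phi> a \<otimes>\<^bsub>S\<^esub> m) ` (carrier R - {\<zero>})"
    using ab eq by simp
qed (auto simp: scaled_eq_zero_iff scaled_not_Unit)

text \<open>The map is additive with trivial kernel by \<open>scaled_eq_zero_iff\<close>.\<close>

lemma inj_on_scaled: "inj_on (\<lambda>a. \<phi> a \<otimes>\<^bsub>S\<^esub> m) (carrier R)"
proof (rule inj_onI)
  fix a b assume ab: "a \<in> carrier R" "b \<in> carrier R" "\<phi> a \<otimes>\<^bsub>S\<^esub> m = \<phi> b \<otimes>\<^bsub>S\<^esub> m"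
  have "\<phi> (a \<ominus> b) \<otimes>\<^bsub>S\<^esub> m = (\<phi> a \<otimes>\<^bsub>S\<^esub> m) \<ominus>\<^bsub>S\<^esub> (\<phi> b \<otimes>\<^bsub>S\<^esub> m)"
    using ab(1,2) by (simp add: a_minus_def S.l_distr S.l_minus)
  also have "\<dots> = \<zero>\<^bsub>S\<^esub>"
    using ab by (simp add: a_minus_def S.r_neg)
  finally have "a \<ominus> b = \<zero>"
    using scaled_eq_zero_iff[of "a \<ominus> b"] ab(1,2) by blast
  thus "a = b"
    using ab by simp
qed

text \<open>Since \<open>\<phi> c\<close> is invertible, \<open>\<phi> c m\<close> generates the
  same ideal as \<open>m\<close>. This excludes every arc between vertices.\<close>

lemma scaled_in_cgenideal:
  assumes "a \<in> carrier R" "c \<in> carrier R" "c \<noteq> \<zero>"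
  shows "\<phi> a \<otimes>\<^bsub>S\<^esub> m \<in> PIdl\<^bsub>S\<^esub> (\<phi> c \<otimes>\<^bsub>S\<^esub> m)"
proof -
  have u: "\<phi> c \<in> Units S"
    using hom_Unit assms by simp
  let ?k = "\<phi> a \<otimes>\<^bsub>S\<^esub> inv\<^bsub>S\<^esub> (\<phi> c)"
  have "?k \<otimes>\<^bsub>S\<^esub> (\<phi> c \<otimes>\<^bsub>S\<^esub> m) = \<phi> a \<otimes>\<^bsub>S\<^esub> m"
    using u assms by (simp add: S.m_assoc inv_cancel_scaled)
  moreover have "?k \<in> carrier S"
    using u assms by simp
  ultimately show ?thesis
    unfolding cgenideal_def by (metis (mono_tags, lifting) mem_Collect_eq)
qed

theorem cozero_divisor_graph_iso_edgeless:
  assumes "finite (carrier R)"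
  shows "digraph_iso (with_proj (cozero_divisor_graph S))
           (with_proj (edgeless_graph (card (carrier R) - 1)))"
proof (rule digraph_iso_edgeless_graphI)
  have V: "pverts (cozero_divisor_graph S) = (\<lambda>a. \<phi> a \<otimes>\<^bsub>S\<^esub> m) ` (carrier R - {\<zero>})"
    by (simp add: cozero_divisor_graph_def nonzero_nonunits Let_def)
  show "finite (pverts (cozero_divisor_graph S))"
    using assms V by simp
  show "card (pverts (cozero_divisor_graph S)) = card (carrier R) - 1"
    unfolding V using assms inj_on_subset[OF inj_on_scaled]
    by (simp add: card_image card_Diff_singleton)
  show "parcs (cozero_divisor_graph S) = {}"
    by (auto simp: cozero_divisor_graph_def nonzero_nonunits Let_def scaled_in_cgenideal)
qed

end

text \<open>Division by \<open>X\<close> leaves a constant remainder.\<close>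

lemma (in field) exists_lin_decomp:
  assumes f: "f \<in> carrier (poly_ring R)"
  shows "\<exists>q \<in> carrier (poly_ring R). \<exists>b \<in> carrier R.
    f = X \<otimes>\<^bsub>poly_ring R\<^esub> q \<oplus>\<^bsub>poly_ring R\<^esub> poly_of_const b"
proof -
  note K = carrier_is_subfield and X = var_closed(1)[OF carrier_is_subring]
  let ?r = "f pmod X"
  \<comment> \<open>\<open>X\<close> is the list \<open>[1, 0]\<close> of degree 1. The zero
    remainder \<open>[]\<close> also has degree 0, because degree is length minus one,
    truncated.\<close>
  have "degree ?r = 0"
    using pmod_degree[OF K f X] by (auto simp: var_def)
  hence "?r \<in> poly_of_const ` carrier R"
    using long_division_closed(2)[OF K f X] by (simp add: poly_of_const_over_carrier)
  thus ?thesis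
    using pdiv_pmod[OF K f X] long_division_closed(1)[OF K f X] by (metis imageE)
qed

text \<open>A nonzero multiple of \<open>X^2\<close> has degree at least 2. This is what makes the
  class of \<open>X\<close> nonzero in the quotient.\<close>

lemma (in field) X_notin_PIdl_X_square:
  "X \<notin> PIdl\<^bsub>poly_ring R\<^esub> (X [^]\<^bsub>poly_ring R\<^esub> (2::nat))"
proof
  interpret P: domain "poly_ring R"
    using univ_poly_is_domain[OF carrier_is_subring] .
  note X = var_closed(1)[OF carrier_is_subring]
  let ?s = "X [^]\<^bsub>poly_ring R\<^esub> (2::nat)"
  have s: "?s \<in> carrier (poly_ring R)"
    using X by simp
  assume "X \<in> PIdl\<^bsub>poly_ring R\<^esub> ?s"
  hence "?s pdivides X"
    unfolding pdivides_def factor_def cgenideal_def using s by (auto simp: P.m_comm)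
  hence "degree ?s \<le> degree X"
    using pdivides_imp_degree_le[OF carrier_is_subring s X] by (simp add: var_def)
  thus False
    using polynomial_pow_degree[OF X, of 2] by (simp add: var_def)
qed

text \<open>Splitting off a constant twice gives \<open>f = x (x q + a) + b\<close>, and
  \<open>\<pi>\<close> kills the term with \<open>x^2\<close>.\<close>

lemma dual_numbers_image:
  fixes R (structure) and P (structure) and Q (structure)
  assumes "field R" and "ring_hom_cring R P \<iota>" and "ring_hom_cring P Q \<pi>"
    and surj: "\<pi> ` carrier P = carrier Q" and x: "x \<in> carrier P"
    and square_zero: "\<pi> (x \<otimes>\<^bsub>P\<^esub> x) = \<zero>\<^bsub>Q\<^esub>" and nonzero: "\<pi> x \<noteq> \<zero>\<^bsub>Q\<^esub>"
    and decomp: "\<And>f. f \<in> carrier P \<Longrightarrow>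
      \<exists>q \<in> carrier P. \<exists>b \<in> carrier R. f = x \<otimes>\<^bsub>P\<^esub> q \<oplus>\<^bsub>P\<^esub> \<iota> b"
  shows "dual_numbers R Q (\<lambda>a. \<pi> (\<iota> a)) (\<pi> x)"
proof -
  interpret \<iota>: ring_hom_cring R P \<iota> by fact
  interpret \<pi>: ring_hom_cring P Q \<pi> by fact
  have square: "\<pi> x \<otimes>\<^bsub>Q\<^esub> \<pi> x = \<zero>\<^bsub>Q\<^esub>"
    using square_zero x by simp
  show ?thesis
  proof (intro dual_numbers.intro dual_numbers_axioms.intro)
    show "ring_hom_cring R Q (\<lambda>a. \<pi> (\<iota> a))"
      by (intro ring_hom_cring.intro ring_hom_cring_axioms.intro ring_hom_memI
        \<iota>.R.is_cring \<pi>.S.is_cring) simp_all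
  next
    fix y assume "y \<in> carrier Q"
    then obtain f where f: "f \<in> carrier P" "y = \<pi> f"
      using surj by blast
    obtain g b where g: "g \<in> carrier P" "b \<in> carrier R" "f = x \<otimes>\<^bsub>P\<^esub> g \<oplus>\<^bsub>P\<^esub> \<iota> b"
      using decomp[OF f(1)] by blast
    \<comment> \<open>Decomposing the quotient \<open>g\<close> once more exposes the coefficient
      \<open>a\<close> of \<open>x\<close>.\<close>
    obtain q a where q: "q \<in> carrier P" "a \<in> carrier R" "g = x \<otimes>\<^bsub>P\<^esub> q \<oplus>\<^bsub>P\<^esub> \<iota> a"
      using decomp[OF g(1)] by blast
    have closed: "\<pi> x \<in> carrier Q" "\<pi> q \<in> carrier Q" "\<pi> (\<iota> a) \<in> carrier Q"
      "\<pi> (\<iota> b) \<in> carrier Q"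
      using x q g by simp_all
    have "y = \<pi> x \<otimes>\<^bsub>Q\<^esub> (\<pi> x \<otimes>\<^bsub>Q\<^esub> \<pi> q \<oplus>\<^bsub>Q\<^esub> \<pi> (\<iota> a)) \<oplus>\<^bsub>Q\<^esub> \<pi> (\<iota> b)"
      unfolding f(2) g(3) q(3) using x q g by simp
    also have "\<dots> = (\<pi> x \<otimes>\<^bsub>Q\<^esub> \<pi> x) \<otimes>\<^bsub>Q\<^esub> \<pi> q
        \<oplus>\<^bsub>Q\<^esub> (\<pi> (\<iota> b) \<oplus>\<^bsub>Q\<^esub> \<pi> (\<iota> a) \<otimes>\<^bsub>Q\<^esub> \<pi> x)"
      using closed by algebra
    also have "\<dots> = \<pi> (\<iota> b) \<oplus>\<^bsub>Q\<^esub> \<pi> (\<iota> a) \<otimes>\<^bsub>Q\<^esub> \<pi> x"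
      unfolding square using closed by simp
    finally show "\<exists>a \<in> carrier R. \<exists>b \<in> carrier R.
        y = \<pi> (\<iota> b) \<oplus>\<^bsub>Q\<^esub> \<pi> (\<iota> a) \<otimes>\<^bsub>Q\<^esub> \<pi> x"
      using q g by blast
  qed (use square x nonzero \<open>field R\<close> in simp_all)
qed

lemma (in ideal) rcos_eq_zero_iff:
  assumes "f \<in> carrier R"
  shows "I +> f = \<zero>\<^bsub>R Quot I\<^esub> \<longleftrightarrow> f \<in> I"
  using rcos_const_imp_mem[OF assms] a_rcos_const by (auto simp: FactRing_def)

text \<open>Here \<open>\<iota>\<close> embeds the constants, \<open>\<pi>\<close> is the coset map,
  and the class of \<open>X\<close> serves as \<open>m\<close>.\<close>

lemma (in field) dual_numbers_poly_quotient:
  defines "I \<equiv> PIdl\<^bsub>poly_ring R\<^esub> (X [^]\<^bsub>poly_ring R\<^esub> (2::nat))"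
  shows "dual_numbers R (poly_ring R Quot I)
    (\<lambda>a. I +>\<^bsub>poly_ring R\<^esub> poly_of_const a) (I +>\<^bsub>poly_ring R\<^esub> X)"
proof (rule dual_numbers_image[where P = "poly_ring R" and \<iota> = poly_of_const
    and \<pi> = "(+>\<^bsub>poly_ring R\<^esub>) I"])
  have P: "cring (poly_ring R)"
    by (rule univ_poly_is_cring[OF carrier_is_subring])
  show X: "X \<in> carrier (poly_ring R)"
    by (rule var_closed(1)[OF carrier_is_subring])
  \<comment> \<open>The power unfolds with a leading one of the polynomial ring;
    \<open>univ_poly_one\<close> is switched off so that this one is not turned into a list.\<close>
  have XX: "X [^]\<^bsub>poly_ring R\<^esub> (2::nat) = X \<otimes>\<^bsub>poly_ring R\<^esub> X"
    using X monoid.l_one[OF univ_poly_is_monoid[OF carrier_is_subring] X]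
    by (simp add: numeral_2_eq_2 del: univ_poly_one)
  have X2: "X [^]\<^bsub>poly_ring R\<^esub> (2::nat) \<in> carrier (poly_ring R)"
    by (rule var_pow_closed[OF carrier_is_subring])
  have I: "ideal I (poly_ring R)"
    unfolding I_def by (rule cring.cgenideal_ideal[OF P X2])
  have "X [^]\<^bsub>poly_ring R\<^esub> (2::nat) \<in> I"
    unfolding I_def by (rule ring.cgenideal_self[OF cring.axioms(1)[OF P] X2])
  thus "I +>\<^bsub>poly_ring R\<^esub> (X \<otimes>\<^bsub>poly_ring R\<^esub> X) = \<zero>\<^bsub>poly_ring R Quot I\<^esub>"
    using ideal.rcos_eq_zero_iff[OF I X2] XX by simp
  show "I +>\<^bsub>poly_ring R\<^esub> X \<noteq> \<zero>\<^bsub>poly_ring R Quot I\<^esub>"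
    using ideal.rcos_eq_zero_iff[OF I X] X_notin_PIdl_X_square I_def by simp
  show "ring_hom_cring (poly_ring R) (poly_ring R Quot I) ((+>\<^bsub>poly_ring R\<^esub>) I)"
    by (rule ideal.rcos_ring_hom_cring[OF I P])
  show "(+>\<^bsub>poly_ring R\<^esub>) I ` carrier (poly_ring R) = carrier (poly_ring R Quot I)"
    by (auto simp: FactRing_def A_RCOSETS_def')
  show "ring_hom_cring R (poly_ring R) poly_of_const"
    using canonical_embedding_is_hom[OF carrier_is_subring] P is_cring
    by (simp add: ring_hom_cring_def ring_hom_cring_axioms_def)
qed (rule field_axioms, rule exists_lin_decomp)

theorem theorem3p1:
  fixes p :: nat
  assumes "Factorial_Ring.prime p"
  shows "digraph_iso (with_proj (cozero_divisor_graph (Zp_x_mod_x2 p)))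
                     (with_proj (edgeless_graph (p - 1)))"
proof -
  interpret Z: residues_prime p "residue_ring (int p)"
    using assms by unfold_locales simp_all
  \<comment> \<open>Primality makes the residue ring a field; together with its size
    \<open>p\<close>, this is all that the abstract result asks for.\<close>
  interpret Z: field "residue_ring (int p)"
    by (rule Z.is_field)
  have "card (carrier (residue_ring (int p))) = p"
    using prime_gt_0_nat[OF assms] by (simp add: residue_ring_def)
  thus ?thesis
    using dual_numbers.cozero_divisor_graph_iso_edgeless[OF Z.dual_numbers_poly_quotient]
    by (simp add: Zp_x_mod_x2_def Let_def residue_ring_def)
qed

end
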